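(* Let $n\ge1$ be an integer, $\alpha,\beta>-1$, $a=\alpha+\beta$, $b=\alpha-\beta$, $c_n\neq0$ a constant, and $$\tau_n(x)=c_n\int_{[-1,1]^n}\Delta_n(z)^2\prod_{k=1}^n e^{xz_k}(1-z_k)^\alpha(1+z_k)^\beta\,dz_k .$$ Then $H(x)=H_n(x)=x\frac{d}{dx}\log\tau_n(x)$ satisfies $$x^2H'''+xH''+6x(H')^2-\big(4H+4x^2-4bx+(2n+a)^2\big)H'+(4x-2b)H+2n(n+a)x-bn(2n+a)=0,$$ with $H(0)=0$ and $H'(0)=\frac{-nb}{a+2n}$.
   Context: $\Delta_n(z)=\prod_{1\le i<j\le n}(z_j-z_i)$ is the Vandermonde determinant. *)

theory Defs
  imports "HOL-Analysis.Analysis"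
begin

definition vandermonde :: "nat \<Rightarrow> (nat \<Rightarrow> real) \<Rightarrow> real" where
  "vandermonde n z = (\<Prod>i<n. \<Prod>j\<in>{i<..<n}. (z j - z i))"

definition tau :: "nat \<Rightarrow> real \<Rightarrow> real \<Rightarrow> real \<Rightarrow> real \<Rightarrow> real" where
  "tau n \<alpha> \<beta> c x = c * (LINT z : (PiE {..<n} (\<lambda>_. {-1..1::real})) | PiM {..<n} (\<lambda>_. lborel).
      (vandermonde n z)^2 * (\<Prod>k<n. exp (x * z k) * (1 - z k) powr \<alpha> * (1 + z k) powr \<beta>))"

end

theory Submission
  imports "Jordan_Normal_Form.Determinant" Defs
begin

text \<open>
  Let \<open>P\<^sub>k\<close> be the monic orthogonal polynomials of the weight
  \<open>e\<^sup>x\<^sup>z (1 - z)\<^sup>\<alpha> (1 + z)\<^sup>\<beta>\<close> on \<open>[-1, 1]\<close>, with squared norms \<open>h\<^sub>k\<close> and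
  recurrence coefficients \<open>b\<^sub>k\<close> and \<open>a\<^sub>k = h\<^sub>k / h\<^sub>k\<^sub>-\<^sub>1\<close>, where \<open>a\<^sub>0 = 0\<close>. Expanding the
  Vandermonde determinant in the \<open>P\<^sub>k\<close> gives \<open>\<tau>\<^sub>n = c n! h\<^sub>0 \<cdots> h\<^sub>n\<^sub>-\<^sub>1\<close>, hence
  \<open>H = x S\<^sub>n\<close> with \<open>S\<^sub>n = b\<^sub>0 + \<cdots> + b\<^sub>n\<^sub>-\<^sub>1\<close>. Differentiating the orthogonality relations in \<open>x\<close>
  gives the Toda equations \<open>S\<^sub>n' = a\<^sub>n\<close> and \<open>a\<^sub>n' = a\<^sub>n (b\<^sub>n - b\<^sub>n\<^sub>-\<^sub>1)\<close>. The only other analytic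
  input is an integration by parts for \<open>n = 0\<close>, a Riccati equation for \<open>b\<^sub>0\<close>. With
  \<open>a = \<alpha> + \<beta>\<close>, \<open>b = \<alpha> - \<beta>\<close> and \<open>N = 2n + a\<close>, the Toda equations propagate it by induction on \<open>n\<close> to

    \<^item> \<open>2 S\<^sub>n + (N + 2) b\<^sub>n + b = x (1 - a\<^sub>n - a\<^sub>n\<^sub>+\<^sub>1 - b\<^sub>n\<^sup>2)\<close>,
    \<^item> \<open>x\<^sup>2 a\<^sub>n (b\<^sub>n + b\<^sub>n\<^sub>-\<^sub>1) + N x a\<^sub>n = N S\<^sub>n + n b\<close>,

  since the derivative of the first, multiplied by \<open>x\<close>, is the step \<open>n \<rightarrow> n + 1\<close> of the second, and
  the derivative of the second, divided by \<open>x a\<^sub>n\<close>, is the step \<open>n - 1 \<rightarrow> n\<close> of the first. Both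
  together imply a quadratic relation between \<open>H' = S\<^sub>n + x a\<^sub>n\<close>, \<open>a\<^sub>n\<close>, \<open>b\<^sub>n\<close> and \<open>b\<^sub>n\<^sub>-\<^sub>1\<close>, and the
  differential equation for \<open>H\<close> is a linear combination of these three relations.
\<close>

section \<open>Toda chains with a Riccati initial condition\<close>

text \<open>\<open>A\<close> and \<open>B\<close> stand for \<alpha> + \<beta> and \<alpha> -
  \<beta>, because \<open>a\<close> and \<open>b\<close> name recurrence coefficients here. Since
  \<open>b 0\<close> has derivative \<open>a 1\<close>, the last assumption is a Riccati equation
  for \<open>b 0\<close>.\<close>

locale jacobi_toda =
  fixes a b S :: "nat \<Rightarrow> real \<Rightarrow> real" and A B :: real
  assumes S_0: "S 0 x = 0"
    and S_Suc: "S (Suc n) x = S n x + b n x"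
    and DERIV_S: "(S n has_real_derivative a n x) (at x)"
    and a_Suc_nonzero: "a (Suc n) x \<noteq> 0"
    and DERIV_a_Suc: "(a (Suc n) has_real_derivative a (Suc n) x * (b (Suc n) x - b n x)) (at x)"
    and riccati: "(2 + A) * b 0 x + B = x * (1 - a 1 x - (b 0 x)\<^sup>2)"
begin

lemma a_0: "a 0 x = 0"
proof -
  have "S 0 = (\<lambda>_. 0)" using S_0 by auto
  then show ?thesis using DERIV_S[of 0 x] by (auto dest: DERIV_unique[OF DERIV_const])
qed

lemma DERIV_a [derivative_intros]:
  "(a n has_real_derivative a n x * (b n x - b (n - 1) x)) (at x)"
proof (cases n)
  case 0
  have "a 0 = (\<lambda>_. 0)" using a_0 by auto
  then show ?thesis using 0 by simp
qed (simp add: DERIV_a_Suc)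

lemma DERIV_b [derivative_intros]:
  "(b n has_real_derivative a (Suc n) x - a n x) (at x)"
proof -
  have "b n = (\<lambda>x. S (Suc n) x - S n x)" by (auto simp: S_Suc)
  then show ?thesis by (auto intro!: DERIV_diff DERIV_S)
qed

lemma isCont_abS: "isCont (a n) x" "isCont (b n) x" "isCont (S n) x"
  using DERIV_a DERIV_b DERIV_S DERIV_isCont by blast+

text \<open>For \<open>n = 0\<close> the truncated index \<open>n - 1\<close> is harmless because \<open>a 0 = 0\<close>.\<close>

lemma string_flow:
  "(\<forall>x. 2 * S n x + (2 * real n + 2 + A) * b n x + B = x * (1 - a n x - a (Suc n) x - (b n x)\<^sup>2)) \<and>
   (\<forall>x. x\<^sup>2 * a n x * (b n x + b (n - 1) x) + (2 * real n + A) * x * a n x = (2 * real n + A) * S n x + real n * B)"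
proof (induction n)
  case 0
  then show ?case using riccati by (simp add: a_0 S_0)
next
  case (Suc n)
  define N where "N = 2 * real n + A"
  have string: "2 * S n x + (N + 2) * b n x + B = x * (1 - a n x - a (Suc n) x - (b n x)\<^sup>2)" for x
    using Suc[THEN conjunct1, rule_format, of x] by (simp add: N_def algebra_simps)
  have flow: "x\<^sup>2 * a n x * (b n x + b (n - 1) x) + N * x * a n x = N * S n x + real n * B" for x
    using Suc by (simp add: N_def)
  have flow': "x\<^sup>2 * a (Suc n) x * (b (Suc n) x + b n x) + (N + 2) * x * a (Suc n) x
      = (N + 2) * S (Suc n) x + real (Suc n) * B" for x
  proof -
    have "((\<lambda>x. 2 * S n x + (N + 2) * b n x + B) has_real_derivative
        2 * a n x + (N + 2) * (a (Suc n) x - a n x)) (at x)"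
      by (auto intro!: derivative_eq_intros DERIV_S)
    moreover have "((\<lambda>x. x * (1 - a n x - a (Suc n) x - (b n x)\<^sup>2)) has_real_derivative
        (1 - a n x - a (Suc n) x - (b n x)\<^sup>2) + x * (- a n x * (b n x - b (n - 1) x)
          - a (Suc n) x * (b (Suc n) x - b n x) - 2 * b n x * (a (Suc n) x - a n x))) (at x)"
      by (rule derivative_eq_intros refl | simp)+
    ultimately have "2 * a n x + (N + 2) * (a (Suc n) x - a n x) =
        (1 - a n x - a (Suc n) x - (b n x)\<^sup>2) + x * (- a n x * (b n x - b (n - 1) x)
          - a (Suc n) x * (b (Suc n) x - b n x) - 2 * b n x * (a (Suc n) x - a n x))"
      using string by (auto dest: DERIV_unique)
    \<comment> \<open>The factor \<open>x\<close> turns the bracket into the left side of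
      \<open>string\<close> and creates the term
      \<open>x\<^sup>2 * a n x * (b n x + b (n - 1) x)\<close>, which \<open>flow\<close>
      eliminates.\<close>
    then have "x * (2 * a n x + (N + 2) * (a (Suc n) x - a n x)) =
        x * ((1 - a n x - a (Suc n) x - (b n x)\<^sup>2) + x * (- a n x * (b n x - b (n - 1) x)
          - a (Suc n) x * (b (Suc n) x - b n x) - 2 * b n x * (a (Suc n) x - a n x)))"
      by simp
    with string[of x] flow[of x] show ?thesis
      by (simp add: S_Suc algebra_simps power2_eq_square)
  qed
  have string': "2 * S (Suc n) x + (N + 4) * b (Suc n) x + B =
      x * (1 - a (Suc n) x - a (Suc (Suc n)) x - (b (Suc n) x)\<^sup>2)" (is "?l x = ?r x") for x
  proof -
    \<comment> \<open>The derivative of \<open>flow'\<close> has the factor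
      \<open>x * a (Suc n) x\<close>, which cancels only for nonzero \<open>x\<close>. What remains
      is the difference of the string equations at \<open>Suc n\<close> and
      \<open>n\<close>.\<close>
    have *: "?l x = ?r x" if "x \<noteq> 0" for x
    proof -
      have "((\<lambda>x. x\<^sup>2 * a (Suc n) x * (b (Suc n) x + b n x) + (N + 2) * x * a (Suc n) x) has_real_derivative
         2 * x * a (Suc n) x * (b (Suc n) x + b n x)
         + x\<^sup>2 * a (Suc n) x * (b (Suc n) x - b n x) * (b (Suc n) x + b n x)
         + x\<^sup>2 * a (Suc n) x * (a (Suc (Suc n)) x - a n x) + (N + 2) * a (Suc n) x
         + (N + 2) * x * a (Suc n) x * (b (Suc n) x - b n x)) (at x)"
        by (rule derivative_eq_intros refl | simp add: algebra_simps power2_eq_square)+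
      moreover have "((\<lambda>x. (N + 2) * S (Suc n) x + real (Suc n) * B) has_real_derivative
          (N + 2) * a (Suc n) x) (at x)"
        by (auto intro!: derivative_eq_intros DERIV_S)
      ultimately have "2 * x * a (Suc n) x * (b (Suc n) x + b n x)
         + x\<^sup>2 * a (Suc n) x * (b (Suc n) x - b n x) * (b (Suc n) x + b n x)
         + x\<^sup>2 * a (Suc n) x * (a (Suc (Suc n)) x - a n x) + (N + 2) * a (Suc n) x
         + (N + 2) * x * a (Suc n) x * (b (Suc n) x - b n x) = (N + 2) * a (Suc n) x"
        using flow' by (auto dest: DERIV_unique)
      then have "(x * a (Suc n) x) * (2 * (b (Suc n) x + b n x)
         + x * (b (Suc n) x - b n x) * (b (Suc n) x + b n x)
         + x * (a (Suc (Suc n)) x - a n x) + (N + 2) * (b (Suc n) x - b n x)) = 0"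
        by (simp add: algebra_simps power2_eq_square)
      then have "2 * (b (Suc n) x + b n x)
         + x * (b (Suc n) x - b n x) * (b (Suc n) x + b n x)
         + x * (a (Suc (Suc n)) x - a n x) + (N + 2) * (b (Suc n) x - b n x) = 0"
        using that a_Suc_nonzero[of n x] by simp
      with string[of x] show ?thesis
        by (simp add: S_Suc algebra_simps power2_eq_square)
    qed
    \<comment> \<open>The point 0, excluded by the cancellation, is recovered by continuity.\<close>
    have "isCont (\<lambda>x. ?l x - ?r x) 0"
      by (intro continuous_intros isCont_abS)
    then have "((\<lambda>x. ?l x - ?r x) \<longlongrightarrow> ?l 0 - ?r 0) (at 0)"
      by (simp add: isCont_def)
    moreover have "((\<lambda>x. ?l x - ?r x) \<longlongrightarrow> 0) (at 0)"
      by (rule tendsto_eventually) (auto simp: eventually_at_filter *)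
    ultimately have "?l 0 = ?r 0"
      using tendsto_unique[OF at_neq_bot] by fastforce
    with * show ?thesis by (cases "x = 0") auto
  qed
  show ?case
    using string' flow' unfolding N_def by (simp add: algebra_simps)
qed

lemmas string_eq = string_flow[THEN conjunct1, rule_format]
lemmas flow_eq = string_flow[THEN conjunct2, rule_format]

text \<open>No further differentiation is needed: both sides vanish for \<open>n = 0\<close>, and
  the step is polynomial algebra from the string equation at \<open>n\<close> and the flow equations
  at \<open>n\<close> and \<open>Suc n\<close>. The sum \<open>S n x + x * a n x\<close> is the
  derivative of \<open>x * S n x\<close>.\<close>

lemma quadric:
  "x * ((S n x + x * a n x)\<^sup>2 + B * (S n x + x * a n x) + real n * (real n + A)) =
   x * a n x * ((x * b n x + 2 * real n + A + 1) * (x * b (n - 1) x + 2 * real n + A - 1) + x\<^sup>2)"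
proof (induction n)
  case 0
  then show ?case by (simp add: a_0 S_0)
next
  case (Suc n)
  define m where "m = real n"
  have m: "real (Suc n) = m + 1" by (simp add: m_def)
  show ?case
    using Suc string_eq[of n x] flow_eq[of x n] flow_eq[of x "Suc n"] S_Suc[of n x]
    unfolding m m_def[symmetric] diff_Suc_1
    by Groebner_Basis.algebra
qed

text \<open>No relation is divided by \<open>x\<close>, so the equation holds at 0 as well.\<close>

lemma sigma_form:
  fixes n :: nat
  assumes "n \<ge> 1"
  defines "H \<equiv> \<lambda>x. x * S n x"
  shows "H differentiable at x" and "deriv H differentiable at x"
    and "(deriv ^^ 2) H differentiable at x"
    and "x^2 * (deriv ^^ 3) H x + x * (deriv ^^ 2) H x + 6 * x * (deriv H x)^2
                - (4 * H x + 4 * x^2 - 4 * B * x + (2 * real n + A)^2) * deriv H x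
                + (4 * x - 2 * B) * H x + 2 * real n * (real n + A) * x
                - B * real n * (2 * real n + A) = 0"
    and "deriv H 0 = S n 0"
proof -
  obtain k where n: "n = Suc k" using assms(1) by (cases n) auto
  \<comment> \<open>\<open>?d\<close> is the logarithmic derivative of \<open>a n\<close>; its own
    derivative is \<open>a (Suc n) x - 2 * a n x + a k x\<close>.\<close>
  let ?d = "\<lambda>x. b n x - b k x"
  define H1 where "H1 = (\<lambda>x. S n x + x * a n x)"
  define H2 where "H2 = (\<lambda>x. 2 * a n x + x * a n x * ?d x)"
  define H3 where "H3 = (\<lambda>x. 3 * a n x * ?d x + x * a n x * (?d x)\<^sup>2
     + x * a n x * (a (Suc n) x - 2 * a n x + a k x))"
  have D1: "(H has_real_derivative H1 x) (at x)" for x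
    unfolding H_def H1_def by (rule derivative_eq_intros DERIV_S refl | simp)+
  have D2: "(H1 has_real_derivative H2 x) (at x)" for x
    unfolding H1_def H2_def
    by (rule derivative_eq_intros DERIV_S refl | simp add: n)+
  have D3: "(H2 has_real_derivative H3 x) (at x)" for x
    unfolding H2_def H3_def
    by (rule derivative_eq_intros DERIV_S refl | simp add: n algebra_simps power2_eq_square)+
  have d1: "deriv H = H1" and d2: "deriv H1 = H2" and d3: "deriv H2 = H3"
    using D1 D2 D3 DERIV_imp_deriv by blast+
  have it: "(deriv ^^ 2) H = H2" "(deriv ^^ 3) H = H3"
    by (simp_all add: numeral_eq_Suc d1 d2 d3)
  show "H differentiable at x" "deriv H differentiable at x" "(deriv ^^ 2) H differentiable at x"
    using D1 D2 D3 unfolding it d1 by (auto simp: real_differentiable_def)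
  show "deriv H 0 = S n 0" by (simp add: d1 H1_def)
  have Sk: "S k x = S n x - b k x" by (simp add: n S_Suc)
  have string_k: "2 * S n x + (2 * real n - 2 + A) * b k x + B = x * (1 - a k x - a n x - (b k x)\<^sup>2)"
    using string_eq[of k x] by (simp add: n Sk[unfolded n] algebra_simps)
  have flow_n: "x\<^sup>2 * a n x * (b n x + b k x) + (2 * real n + A) * x * a n x =
      (2 * real n + A) * S n x + real n * B"
    using flow_eq[of x n] by (simp add: n)
  have quadric_n: "x * ((S n x + x * a n x)\<^sup>2 + B * (S n x + x * a n x) + real n * (real n + A)) =
      x * a n x * ((x * b n x + 2 * real n + A + 1) * (x * b k x + 2 * real n + A - 1) + x\<^sup>2)"
    using quadric[of x n] by (simp add: n)
  \<comment> \<open>The multiplier \<open>x\<^sup>2 * a n x\<close> of the two string equations is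
    dictated by the terms with \<open>a (Suc n)\<close> and \<open>a k\<close>, which occur only in
    \<open>H3\<close>. Flow and quadric account for the rest.\<close>
  have "x^2 * H3 x + x * H2 x + 6 * x * (H1 x)^2
        - (4 * H x + 4 * x^2 - 4 * B * x + (2 * real n + A)^2) * H1 x
        + (4 * x - 2 * B) * H x + 2 * real n * (real n + A) * x
        - B * real n * (2 * real n + A) =
      x\<^sup>2 * a n x * ((2 * S n x + (2 * real n + 2 + A) * b n x + B
            - x * (1 - a n x - a (Suc n) x - (b n x)\<^sup>2))
          + (2 * S n x + (2 * real n - 2 + A) * b k x + B
            - x * (1 - a k x - a n x - (b k x)\<^sup>2)))
      + (2 * real n + A) * (x\<^sup>2 * a n x * (b n x + b k x) + (2 * real n + A) * x * a n x
          - ((2 * real n + A) * S n x + real n * B))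
      + 2 * (x * ((S n x + x * a n x)\<^sup>2 + B * (S n x + x * a n x) + real n * (real n + A))
          - x * a n x * ((x * b n x + 2 * real n + A + 1) * (x * b k x + 2 * real n + A - 1) + x\<^sup>2))"
    unfolding H1_def H2_def H3_def H_def
    by (simp add: algebra_simps power2_eq_square)
  also have "\<dots> = 0"
    using string_eq[of n x] string_k flow_n quadric_n by simp
  finally show "x^2 * (deriv ^^ 3) H x + x * (deriv ^^ 2) H x + 6 * x * (deriv H x)^2
                - (4 * H x + 4 * x^2 - 4 * B * x + (2 * real n + A)^2) * deriv H x
                + (4 * x - 2 * B) * H x + 2 * real n * (real n + A) * x
                - B * real n * (2 * real n + A) = 0"
    unfolding it d1 .
qed

end

section \<open>Orthogonal polynomials of a deformed moment functional\<close>

text \<open>Differentiation is coefficientwise in the parameter. The degree bound, uniform in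
  \<open>y\<close>, lets a linear functional of the family be written as a finite sum of fixed
  length.\<close>

definition has_poly_derivative :: "(real \<Rightarrow> real poly) \<Rightarrow> real poly \<Rightarrow> real \<Rightarrow> bool" where
  "has_poly_derivative Q Q' x \<longleftrightarrow>
     (\<exists>N. \<forall>y. degree (Q y) \<le> N) \<and>
     (\<forall>i. ((\<lambda>y. coeff (Q y) i) has_real_derivative coeff Q' i) (at x))"

lemma has_poly_derivative_coeff:
  "has_poly_derivative Q Q' x \<Longrightarrow> ((\<lambda>y. coeff (Q y) i) has_real_derivative coeff Q' i) (at x)"
  by (simp add: has_poly_derivative_def)

lemma has_poly_derivative_const: "has_poly_derivative (\<lambda>_. q) 0 x"
  by (auto simp: has_poly_derivative_def)

lemma has_poly_derivative_diff:
  assumes "has_poly_derivative Q Q' x" "has_poly_derivative R R' x"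
  shows "has_poly_derivative (\<lambda>y. Q y - R y) (Q' - R') x"
proof -
  obtain N M where "\<And>y. degree (Q y) \<le> N" "\<And>y. degree (R y) \<le> M"
    using assms by (auto simp: has_poly_derivative_def)
  then have "\<forall>y. degree (Q y - R y) \<le> max N M"
    by (auto intro!: degree_diff_le intro: order_trans[OF _ max.cobounded1] order_trans[OF _ max.cobounded2])
  then show ?thesis
    using assms by (auto simp: has_poly_derivative_def intro!: DERIV_diff)
qed

lemma has_poly_derivative_add:
  assumes "has_poly_derivative Q Q' x" "has_poly_derivative R R' x"
  shows "has_poly_derivative (\<lambda>y. Q y + R y) (Q' + R') x"
  using has_poly_derivative_diff[OF assms(1) has_poly_derivative_diff[OF has_poly_derivative_const[of 0] assms(2)]]
  by simp

lemma has_poly_derivative_smult: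
  assumes "(f has_real_derivative f') (at x)" "has_poly_derivative Q Q' x"
  shows "has_poly_derivative (\<lambda>y. smult (f y) (Q y)) (smult f' (Q x) + smult (f x) Q') x"
proof -
  obtain N where "\<And>y. degree (Q y) \<le> N"
    using assms by (auto simp: has_poly_derivative_def)
  then have "\<forall>y. degree (smult (f y) (Q y)) \<le> N"
    using degree_smult_le order_trans by blast
  then show ?thesis
    using assms unfolding has_poly_derivative_def
    by (auto intro!: derivative_eq_intros simp: mult.commute)
qed

lemma has_poly_derivative_sum:
  assumes "\<And>k. k \<in> A \<Longrightarrow> has_poly_derivative (Q k) (Q' k) x"
  shows "has_poly_derivative (\<lambda>y. \<Sum>k\<in>A. Q k y) (\<Sum>k\<in>A. Q' k) x"
  using assms
  by (induction A rule: infinite_finite_induct)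
     (auto intro: has_poly_derivative_const has_poly_derivative_add)

lemma has_poly_derivative_mult:
  assumes "has_poly_derivative Q Q' x" "has_poly_derivative R R' x"
  shows "has_poly_derivative (\<lambda>y. Q y * R y) (Q' * R x + Q x * R') x"
proof -
  obtain N M where "\<And>y. degree (Q y) \<le> N" "\<And>y. degree (R y) \<le> M"
    using assms by (auto simp: has_poly_derivative_def)
  then have "\<forall>y. degree (Q y * R y) \<le> N + M"
    using degree_mult_le add_mono order_trans by blast
  moreover have "((\<lambda>y. coeff (Q y * R y) i) has_real_derivative coeff (Q' * R x + Q x * R') i) (at x)" for i
    unfolding coeff_mult coeff_add sum.distrib[symmetric]
    using assms by (auto intro!: derivative_eq_intros has_poly_derivative_coeff sum.cong)
  ultimately show ?thesis by (auto simp: has_poly_derivative_def)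
qed

text \<open>Abstracts integration against \<open>e\<^sup>x\<^sup>z w(z)\<close>: differentiating in
  \<open>x\<close> multiplies the integrand by \<open>z\<close>, which is \<open>pCons 0\<close> on
  polynomials.\<close>

locale moment_functional =
  fixes L :: "real \<Rightarrow> real poly \<Rightarrow> real"
  assumes L_add: "L x (p + q) = L x p + L x q"
    and L_smult: "L x (smult c p) = c * L x p"
    and L_square_pos: "p \<noteq> 0 \<Longrightarrow> 0 < L x (p * p)"
    and DERIV_L: "((\<lambda>y. L y p) has_real_derivative L x (pCons 0 p)) (at x)"
begin

lemma L_0: "L x 0 = 0"
  using L_smult[of x 0 0] by simp

lemma L_minus: "L x (- p) = - L x p"
  using L_add[of x p "-p"] by (simp add: L_0)

lemma L_diff: "L x (p - q) = L x p - L x q"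
  using L_add[of x p "- q"] by (simp add: L_minus)

lemma L_sum: "L x (\<Sum>i\<in>A. f i) = (\<Sum>i\<in>A. L x (f i))"
  by (induction A rule: infinite_finite_induct) (auto simp: L_0 L_add)

text \<open>Product rule for a functional and an argument that both depend on \<open>x\<close>:
  expand in monomials up to a common degree and differentiate each product.\<close>

lemma DERIV_L_family:
  assumes "has_poly_derivative Q Q' x"
  shows "((\<lambda>y. L y (Q y)) has_real_derivative L x Q' + L x (pCons 0 (Q x))) (at x)"
proof -
  obtain N0 where N0: "\<And>y. degree (Q y) \<le> N0"
    using assms by (auto simp: has_poly_derivative_def)
  define N where "N = max N0 (degree Q')"
  have "degree (Q y) \<le> N" for y using N0[of y] by (simp add: N_def)
  then have Q: "Q y = (\<Sum>i\<le>N. smult (coeff (Q y) i) (monom 1 i))" for y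
    by (metis (no_types, lifting) mult.right_neutral poly_as_sum_of_monoms' smult_monom sum.cong)
  have Q': "Q' = (\<Sum>i\<le>N. smult (coeff Q' i) (monom 1 i))"
    by (metis (no_types, lifting) N_def max.cobounded2 mult.right_neutral poly_as_sum_of_monoms' smult_monom sum.cong)
  have "((\<lambda>y. \<Sum>i\<le>N. coeff (Q y) i * L y (monom 1 i)) has_real_derivative
      (\<Sum>i\<le>N. coeff Q' i * L x (monom 1 i) + coeff (Q x) i * L x (pCons 0 (monom 1 i)))) (at x)"
    using has_poly_derivative_coeff[OF assms]
    by (auto intro!: derivative_eq_intros DERIV_L simp: algebra_simps)
  moreover have "(\<Sum>i\<le>N. coeff (Q y) i * L y (monom 1 i)) = L y (Q y)" for y
    by (subst (2) Q) (simp add: L_sum L_smult del: smult_monom)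
  moreover have "(\<Sum>i\<le>N. coeff Q' i * L x (monom 1 i)) = L x Q'"
    by (subst (2) Q') (simp add: L_sum L_smult del: smult_monom)
  moreover have "(\<Sum>i\<le>N. coeff (Q x) i * L x (pCons 0 (monom 1 i))) = L x (pCons 0 (Q x))"
  proof -
    have "L x ([:0, 1:] * Q x) = L x (\<Sum>i\<le>N. smult (coeff (Q x) i) ([:0, 1:] * monom 1 i))"
      by (subst Q) (simp only: sum_distrib_left mult_smult_right)
    also have "\<dots> = (\<Sum>i\<le>N. coeff (Q x) i * L x ([:0, 1:] * monom 1 i))"
      by (simp only: L_sum L_smult)
    finally show ?thesis by simp
  qed
  ultimately show ?thesis by (simp add: sum.distrib)
qed

section \<open>Monic orthogonal polynomials by Gram-Schmidt\<close>

function P :: "real \<Rightarrow> nat \<Rightarrow> real poly" where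
  "P x n = monom 1 n - (\<Sum>k<n. smult (L x (monom 1 n * P x k) / L x (P x k * P x k)) (P x k))"
  by auto
termination by (relation "Wellfounded.measure snd") auto

declare P.simps [simp del]

definition h where "h x n = L x (P x n * P x n)"
text \<open>The diagonal coefficient of the three-term recurrence \<open>z P\<^sub>n =
  P\<^sub>n\<^sub>+\<^sub>1 + b\<^sub>n P\<^sub>n + a\<^sub>n
  P\<^sub>n\<^sub>-\<^sub>1\<close>.\<close>

definition b where "b x n = L x (pCons 0 (P x n * P x n)) / h x n"

lemma degree_P_le: "degree (P x n) \<le> n" and coeff_P: "coeff (P x n) n = 1"
proof (induction n rule: less_induct)
  case (less n)
  let ?S = "\<Sum>k<n. smult (L x (monom 1 n * P x k) / L x (P x k * P x k)) (P x k)"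
  { case 1
    have "degree ?S \<le> n"
    proof (intro degree_sum_le)
      fix k assume k: "k \<in> {..<n}"
      have "degree (P x k) \<le> n" using less(1)[of k] k by simp
      then show "degree (smult (L x (monom 1 n * P x k) / L x (P x k * P x k)) (P x k)) \<le> n"
        using degree_smult_le order_trans by blast
    qed simp
    then show ?case
      by (subst P.simps) (intro degree_diff_le degree_monom_le)
  next
    case 2
    have "coeff (P x k) n = 0" if "k < n" for k
      using less(1)[OF that] that by (intro coeff_eq_0) auto
    then show ?case
      by (subst P.simps) (simp add: coeff_sum)
  }
qed

lemma P_0: "P x 0 = 1"
  by (subst P.simps) (simp add: monom_0)

lemma P_nonzero: "P x n \<noteq> 0"
  using coeff_P[of x n] by auto

lemma h_pos: "h x n > 0"
  unfolding h_def by (intro L_square_pos P_nonzero)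

lemma P_orthogonal: "k < n \<Longrightarrow> L x (P x n * P x k) = 0"
proof (induction n arbitrary: k rule: less_induct)
  case (less n)
  have orth: "L x (P x j * P x k) = (if j = k then h x k else 0)" if "j < n" for j
    using less.IH[of j k] less.IH[of k j] that less.prems
    by (cases j k rule: linorder_cases) (auto simp: h_def mult.commute)
  have "L x (P x n * P x k) = L x (monom 1 n * P x k)
      - (\<Sum>j<n. L x (monom 1 n * P x j) / h x j * L x (P x j * P x k))"
    by (subst P.simps) (simp add: left_diff_distrib L_diff sum_distrib_right L_sum L_smult h_def)
  also have "(\<Sum>j<n. L x (monom 1 n * P x j) / h x j * L x (P x j * P x k))
      = (\<Sum>j<n. if j = k then L x (monom 1 n * P x k) else 0)"
    by (rule sum.cong) (use h_pos[of x k] in \<open>auto simp: orth\<close>)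
  finally show ?case using less.prems by simp
qed

lemma L_P_mult_P: "L x (P x i * P x j) = (if i = j then h x i else 0)"
  using P_orthogonal[of i j x] P_orthogonal[of j i x]
  by (cases i j rule: linorder_cases) (auto simp: h_def mult.commute)

text \<open>Subtracting a multiple of \<open>P x m\<close> removes the top coefficient. The degree
  bound is stated by coefficients so that \<open>m = 0\<close> covers the zero polynomial.\<close>

lemma L_mult_P_eq_0:
  assumes "\<And>i. i \<ge> m \<Longrightarrow> coeff Q i = 0" "m \<le> n"
  shows "L x (Q * P x n) = 0"
  using assms
proof (induction m arbitrary: Q)
  case 0
  then have "Q = 0" by (simp add: poly_eq_iff)
  then show ?case by (simp add: L_0)
next
  case (Suc m)
  let ?R = "Q - smult (coeff Q m) (P x m)"
  have *: "coeff ?R i = 0" if "i \<ge> m" for i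
    using that Suc.prems(1)[of i] degree_P_le[of x m] coeff_P[of x m]
    by (cases "i = m") (auto simp: coeff_eq_0)
  have "L x (?R * P x n) = 0"
    using Suc.prems(2) by (intro Suc.IH *) simp_all
  moreover have "L x (P x m * P x n) = 0"
    using P_orthogonal[of m n x] Suc.prems(2) by (simp add: mult.commute)
  ultimately show ?case
    by (simp add: left_diff_distrib L_diff L_smult)
qed

lemma L_mult_P:
  assumes "degree Q \<le> n"
  shows "L x (Q * P x n) = coeff Q n * h x n"
proof -
  let ?R = "Q - smult (coeff Q n) (P x n)"
  have "coeff ?R i = 0" if "i \<ge> n" for i
    using that assms degree_P_le[of x n] coeff_P[of x n]
    by (cases "i = n") (auto simp: coeff_eq_0)
  then have "L x (?R * P x n) = 0"
    by (rule L_mult_P_eq_0) auto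
  then show ?thesis
    by (simp add: left_diff_distrib L_diff L_smult h_def)
qed

section \<open>Dependence on \<open>x\<close> and the Toda equations\<close>

lemma P_has_poly_derivative: "\<exists>Q'. has_poly_derivative (\<lambda>y. P y n) Q' x"
proof (induction n rule: less_induct)
  case (less n)
  have "\<exists>Q'. has_poly_derivative (\<lambda>y. smult (L y (monom 1 n * P y k) / L y (P y k * P y k)) (P y k)) Q' x"
    if k: "k \<in> {..<n}" for k
  proof -
    from k less obtain R where R: "has_poly_derivative (\<lambda>y. P y k) R x" by auto
    have "L x (P x k * P x k) \<noteq> 0" using h_pos[of x k] by (simp add: h_def)
    then have "\<exists>D. ((\<lambda>y. L y (monom 1 n * P y k) / L y (P y k * P y k)) has_real_derivative D) (at x)"
      using DERIV_divide[OF DERIV_L_family[OF has_poly_derivative_mult[OF has_poly_derivative_const R]]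
          DERIV_L_family[OF has_poly_derivative_mult[OF R R]]] by blast
    then show ?thesis using has_poly_derivative_smult R by blast
  qed
  then have "\<forall>k\<in>{..<n}. \<exists>Q'. has_poly_derivative
      (\<lambda>y. smult (L y (monom 1 n * P y k) / L y (P y k * P y k)) (P y k)) Q' x"
    by blast
  from bchoice[OF this] obtain Q' where Q': "has_poly_derivative (\<lambda>y. smult (L y (monom 1 n * P y k) / L y (P y k * P y k)) (P y k)) (Q' k) x"
    if "k \<in> {..<n}" for k
    by blast
  have "has_poly_derivative (\<lambda>y. monom 1 n - (\<Sum>k<n. smult (L y (monom 1 n * P y k) / L y (P y k * P y k)) (P y k)))
      (0 - (\<Sum>k<n. Q' k)) x"
    by (intro has_poly_derivative_diff has_poly_derivative_const has_poly_derivative_sum Q')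
  moreover have "(\<lambda>y. monom 1 n - (\<Sum>k<n. smult (L y (monom 1 n * P y k) / L y (P y k * P y k)) (P y k))) = (\<lambda>y. P y n)"
    by (rule ext, rule P.simps[symmetric])
  ultimately show ?case by metis
qed

text \<open>The leading coefficient is constantly 1, so the derivative in \<open>x\<close> has lower
  degree and is orthogonal to \<open>P x n\<close>.\<close>

lemma P_derivative:
  obtains D where "has_poly_derivative (\<lambda>y. P y n) D x" "\<And>i. i \<ge> n \<Longrightarrow> coeff D i = 0"
proof -
  obtain D where D: "has_poly_derivative (\<lambda>y. P y n) D x"
    using P_has_poly_derivative by blast
  moreover have "coeff D i = 0" if "i \<ge> n" for i
  proof -
    have "(\<lambda>y. coeff (P y n) i) = (\<lambda>_. if i = n then 1 else 0)"
      using degree_P_le that by (auto simp: coeff_P intro!: coeff_eq_0 le_less_trans[OF degree_P_le])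
    with has_poly_derivative_coeff[OF D, of i] show ?thesis
      by (auto dest: DERIV_unique[OF DERIV_const])
  qed
  ultimately show ?thesis using that by blast
qed

text \<open>Both terms with the derivative of \<open>P x n\<close> vanish by orthogonality; only the
  derivative of the weight contributes.\<close>

lemma DERIV_h: "((\<lambda>y. h y n) has_real_derivative b x n * h x n) (at x)"
proof -
  obtain D where D: "has_poly_derivative (\<lambda>y. P y n) D x" "\<And>i. i \<ge> n \<Longrightarrow> coeff D i = 0"
    using P_derivative by blast
  have "L x (D * P x n) = 0"
    using D(2) by (rule L_mult_P_eq_0) auto
  then have "L x (D * P x n + P x n * D) = 0"
    by (simp only: L_add mult.commute[of "P x n" D])
  with DERIV_L_family[OF has_poly_derivative_mult[OF D(1) D(1)]] h_pos[of x n]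
  show ?thesis by (simp add: h_def b_def)
qed

text \<open>\<open>S x n\<close> is minus the subleading coefficient of \<open>P x n\<close>, that is, the sum of its roots.\<close>

definition S where "S x n = (case n of 0 \<Rightarrow> 0 | Suc k \<Rightarrow> - coeff (P x (Suc k)) k)"

lemma S_0: "S x 0 = 0"
  by (simp add: S_def)

text \<open>The polynomial \<open>z P\<^sub>n - P\<^sub>n\<^sub>+\<^sub>1\<close> has degree at most
  \<open>n\<close>, with coefficient \<open>S x (Suc n) - S x n\<close> there; pairing it with
  \<open>P x n\<close> isolates that coefficient.\<close>

lemma S_Suc: "S x (Suc n) = S x n + b x n"
proof -
  let ?Q = "pCons 0 (P x n) - P x (Suc n)"
  have c: "coeff ?Q i = 0" if "i > n" for i
    using that coeff_P[of x n] coeff_P[of x "Suc n"] degree_P_le[of x n] degree_P_le[of x "Suc n"]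
    by (cases "i = Suc n") (auto simp: coeff_pCons coeff_eq_0 split: nat.splits)
  then have "degree ?Q \<le> n" by (intro degree_le) auto
  then have "L x (?Q * P x n) = coeff ?Q n * h x n"
    by (rule L_mult_P)
  moreover have "L x (P x (Suc n) * P x n) = 0"
    by (rule P_orthogonal) simp
  ultimately have "b x n = coeff ?Q n"
    using h_pos[of x n] by (simp add: b_def left_diff_distrib L_diff field_simps)
  then show ?thesis
    by (cases n) (simp_all add: S_def)
qed

text \<open>Differentiate the orthogonality of \<open>P x (Suc n)\<close> and \<open>P x n\<close>.
  Two terms survive: the subleading coefficient of the first polynomial moves, and the weight
  contributes \<open>h x (Suc n)\<close>.\<close>

lemma DERIV_S_Suc:
  "((\<lambda>y. S y (Suc n)) has_real_derivative h x (Suc n) / h x n) (at x)"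
proof -
  obtain D where D: "has_poly_derivative (\<lambda>y. P y n) D x" "\<And>i. i \<ge> n \<Longrightarrow> coeff D i = 0"
    using P_derivative by blast
  obtain E where E: "has_poly_derivative (\<lambda>y. P y (Suc n)) E x" "\<And>i. i \<ge> Suc n \<Longrightarrow> coeff E i = 0"
    using P_derivative by blast
  have 1: "L x (P x (Suc n) * D) = 0"
    unfolding mult.commute[of "P x (Suc n)"] using D(2) by (rule L_mult_P_eq_0) auto
  have "degree E \<le> n" using E(2) by (intro degree_le) auto
  then have 2: "L x (E * P x n) = coeff E n * h x n"
    by (rule L_mult_P)
  have "degree (pCons 0 (P x n)) \<le> Suc n"
    using degree_P_le[of x n] degree_pCons_le[of 0 "P x n"] by linarith
  from L_mult_P[OF this] have 3: "L x (pCons 0 (P x (Suc n) * P x n)) = h x (Suc n)"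
    by (simp add: coeff_P mult.commute)
  have "(\<lambda>y. L y (P y (Suc n) * P y n)) = (\<lambda>_. 0)"
    using P_orthogonal by auto
  with DERIV_L_family[OF has_poly_derivative_mult[OF E(1) D(1)]]
  have "L x (E * P x n + P x (Suc n) * D) + L x (pCons 0 (P x (Suc n) * P x n)) = 0"
    by (auto dest: DERIV_unique[OF DERIV_const])
  then have "- coeff E n = h x (Suc n) / h x n"
    using 1 2 3 h_pos[of x n] by (simp add: L_add field_simps)
  then show ?thesis
    using DERIV_minus[OF has_poly_derivative_coeff[OF E(1), of n]] by (simp add: S_def)
qed

text \<open>Summing the logarithmic derivatives \<open>b x k\<close> of the norms gives
  \<open>S x n\<close>; this is the logarithmic derivative of the matrix integral.\<close>

lemma DERIV_prod_h:
  "((\<lambda>y. \<Prod>k<n. h y k) has_real_derivative (\<Prod>k<n. h x k) * S x n) (at x)"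
proof (induction n)
  case 0
  then show ?case by (simp add: S_0)
next
  case (Suc n)
  from DERIV_mult[OF Suc DERIV_h[of n x]] show ?case
    by (simp add: S_Suc algebra_simps)
qed

end

section \<open>The Vandermonde determinant in a monic polynomial basis\<close>

lemma vandermonde_Suc: "vandermonde (Suc n) z = vandermonde n z * (\<Prod>i<n. z n - z i)"
proof -
  have "{i<..<Suc n} = insert n {i<..<n}" if "i < n" for i using that by auto
  then have "(\<Prod>j\<in>{i<..<Suc n}. z j - z i) = (z n - z i) * (\<Prod>j\<in>{i<..<n}. z j - z i)" if "i < n" for i
    using that by simp
  then have "(\<Prod>i<n. \<Prod>j\<in>{i<..<Suc n}. z j - z i) = (\<Prod>i<n. z n - z i) * (\<Prod>i<n. \<Prod>j\<in>{i<..<n}. z j - z i)"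
    by (simp add: prod.distrib[symmetric])
  moreover have "{n<..<Suc n} = {}" by auto
  ultimately show ?thesis by (simp add: vandermonde_def mult.commute)
qed

lemma vandermonde_not_inj:
  assumes "i < n" "j < n" "i \<noteq> j" "z i = z j"
  shows "vandermonde n z = 0"
proof -
  have *: ?thesis if "i < j" "j < n" "z i = z j" for i j
    using that unfolding vandermonde_def by (intro prod_zero bexI[of _ i] bexI[of _ j]) auto
  from *[of i j] *[of j i] show ?thesis using assms by (cases i j rule: linorder_cases) auto
qed

lemma vandermonde_eq_det:
  fixes Q :: "nat \<Rightarrow> real poly"
  assumes deg: "\<And>j. degree (Q j) \<le> j" and monic: "\<And>j. coeff (Q j) j = 1"
  shows "vandermonde n z = Determinant.det (Matrix.mat n n (\<lambda>(i, j). poly (Q j) (z i)))"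
proof (induction n)
  case 0
  then show ?case by (simp add: vandermonde_def)
next
  case (Suc n)
  let ?M = "\<lambda>m (z :: nat \<Rightarrow> real). Matrix.mat m m (\<lambda>(i, j). poly (Q j) (z i))"
  have identical: "Determinant.det (?M m y) = 0" if "i < m" "j < m" "i \<noteq> j" "y i = y j" for m y i j
    by (rule Determinant.det_identical_rows[of _ m i j]) (use that in \<open>auto intro!: eq_vecI\<close>)
  show ?case
  \<comment> \<open>Only the first \<open>n\<close> points must be distinct, as they supply the
    \<open>n\<close> roots; \<open>z n\<close> is the variable.\<close>
  proof (cases "inj_on z {..<n}")
    case False
    then obtain i j where ij: "i < n" "j < n" "i \<noteq> j" "z i = z j"
      by (auto simp: inj_on_def)
    then show ?thesis
      using vandermonde_not_inj[of i "Suc n" j z] identical[of i "Suc n" j z] by simp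
  next
    case True
    \<comment> \<open>As a polynomial in the last variable, the determinant has the roots \<open>z\<^sub>0, \<dots>, z\<^sub>n\<^sub>-\<^sub>1\<close>
      and, by the induction hypothesis, the leading coefficient \<open>vandermonde n z\<close>.\<close>
    define q where "q = (\<Sum>j<Suc n. smult (cofactor (?M (Suc n) z) n j) (Q j))"
    have cof: "cofactor (?M (Suc n) (z(n := t))) n j = cofactor (?M (Suc n) z) n j" if "j < Suc n" for t j
      unfolding cofactor_def mat_delete_def using that
      by (intro arg_cong2[where f = "(*)"] refl arg_cong[where f = Determinant.det] eq_matI) auto
    have q: "poly q t = Determinant.det (?M (Suc n) (z(n := t)))" for t
    proof -
      have "Determinant.det (?M (Suc n) (z(n := t))) = (\<Sum>j<Suc n. ?M (Suc n) (z(n := t)) $$ (n, j) *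
          cofactor (?M (Suc n) (z(n := t))) n j)"
        by (rule laplace_expansion_row) auto
      also have "\<dots> = (\<Sum>j<Suc n. poly (Q j) t * cofactor (?M (Suc n) z) n j)"
        by (intro sum.cong refl arg_cong2[where f = "(*)"] cof) auto
      finally show ?thesis by (simp add: q_def poly_sum mult.commute)
    qed
    have "mat_delete (?M (Suc n) z) n n = ?M n z"
      by (rule eq_matI) (auto simp: mat_delete_def)
    then have cof_n: "cofactor (?M (Suc n) z) n n = vandermonde n z"
      by (simp add: cofactor_def Suc)
    let ?r = "smult (vandermonde n z) (\<Prod>i<n. [:- z i, 1:])"
    have deg_prod: "degree (\<Prod>i<n. [:- z i, 1:]) = n"
      by (subst degree_prod_eq_sum_degree) auto
    have "lead_coeff (\<Prod>i<n. [:- z i, 1:]) = 1"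
      by (subst lead_coeff_prod) simp
    then have coeff_prod: "coeff (\<Prod>i<n. [:- z i, 1:]) n = 1"
      by (simp add: deg_prod)
    have "coeff (q - ?r) i = 0" if "i \<ge> n" for i
    proof (cases "i = n")
      case True
      have "coeff q n = (\<Sum>j<Suc n. cofactor (?M (Suc n) z) n j * coeff (Q j) n)"
        by (simp add: q_def coeff_sum)
      also have "\<dots> = (\<Sum>j<Suc n. if j = n then vandermonde n z else 0)"
        using deg by (intro sum.cong) (auto simp: cof_n monic intro!: coeff_eq_0 le_less_trans[OF deg])
      finally show ?thesis using True coeff_prod by simp
    next
      case False
      with that have "i > n" by simp
      then have "coeff (Q j) i = 0" if "j < Suc n" for j
        using that by (intro coeff_eq_0 le_less_trans[OF deg]) auto
      then have "coeff q i = 0" by (simp add: q_def coeff_sum)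
      moreover have "coeff (\<Prod>i<n. [:- z i, 1:]) i = 0"
        using \<open>i > n\<close> by (intro coeff_eq_0) (simp add: deg_prod)
      ultimately show ?thesis by simp
    qed
    then have small: "q - ?r = 0 \<or> degree (q - ?r) < n"
      by (metis leading_coeff_0_iff not_le)
    have roots: "poly (q - ?r) (z i) = 0" if "i < n" for i
    proof -
      have "poly q (z i) = 0"
        unfolding q by (rule identical[of i _ n]) (use that in auto)
      moreover have "poly ?r (z i) = 0"
        using that by (auto simp: poly_prod intro!: prod_zero)
      ultimately show ?thesis by simp
    qed
    have "q - ?r = 0"
    proof (rule ccontr)
      assume nz: "q - ?r \<noteq> 0"
      have "z ` {..<n} \<subseteq> {t. poly (q - ?r) t = 0}" using roots by auto
      then have "card (z ` {..<n}) \<le> card {t. poly (q - ?r) t = 0}"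
        by (rule card_mono[OF poly_roots_finite[OF nz]])
      also have "\<dots> \<le> degree (q - ?r)"
        by (rule card_poly_roots_bound[OF nz])
      also have "\<dots> < n" using small nz by blast
      finally show False using card_image[OF True] by simp
    qed
    then have "poly q (z n) = vandermonde n z * (\<Prod>i<n. z n - z i)"
      by (simp add: poly_prod)
    then show ?thesis by (simp add: q vandermonde_Suc)
  qed
qed

text \<open>The Leibniz expansion makes each term a product over the variables, ready for
  coordinatewise integration.\<close>

lemma vandermonde_eq_alternant:
  fixes Q :: "nat \<Rightarrow> real poly"
  assumes "\<And>j. degree (Q j) \<le> j" and "\<And>j. coeff (Q j) j = 1"
  shows "vandermonde n z = (\<Sum>p | p permutes {..<n}. of_int (sign p) * (\<Prod>i<n. poly (Q (p i)) (z i)))"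
proof -
  have *: "p i < n" if "p permutes {..<n}" "i < n" for p i
    using permutes_in_image[OF that(1), of i] that(2) by simp
  show ?thesis
    by (subst vandermonde_eq_det[of Q, OF assms], subst Determinant.det_def'[of _ n])
       (auto simp: atLeast0LessThan * intro!: sum.cong)
qed

section \<open>The deformed Jacobi weight\<close>

text \<open>The indicator turns all integrals into integrals over the line. As
  \<open>0 powr \<alpha> = 0\<close> for every exponent, the weight is 0 at both endpoints, which
  changes only a null set.\<close>

definition jacobi_weight :: "real \<Rightarrow> real \<Rightarrow> real \<Rightarrow> real" where
  "jacobi_weight \<alpha> \<beta> z = indicator {-1..1} z * ((1 - z) powr \<alpha> * (1 + z) powr \<beta>)"

definition jacobi_moment :: "real \<Rightarrow> real \<Rightarrow> real \<Rightarrow> real poly \<Rightarrow> real" where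
  "jacobi_moment \<alpha> \<beta> x p = (\<integral>z. poly p z * exp (x * z) * jacobi_weight \<alpha> \<beta> z \<partial>lborel)"

lemma jacobi_weight_nonneg: "jacobi_weight \<alpha> \<beta> z \<ge> 0"
  by (simp add: jacobi_weight_def)

lemma measurable_jacobi_weight [measurable]: "jacobi_weight \<alpha> \<beta> \<in> borel_measurable borel"
  unfolding jacobi_weight_def by measurable

text \<open>The substitution \<open>t = (1 + z) / 2\<close> reduces this to the Beta integral;
  \<open>2 powr (\<alpha> + \<beta>)\<close> compensates for the halved bases.\<close>

lemma integrable_jacobi_weight:
  assumes "\<alpha> > -1" "\<beta> > -1"
  shows "integrable lborel (jacobi_weight \<alpha> \<beta>)"
proof -
  let ?g = "\<lambda>t::real. t powr \<beta> * (1 - t) powr \<alpha>"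
  have "?g integrable_on {0..1}"
    using has_integral_Beta_real[of "\<beta> + 1" "\<alpha> + 1"] assms by (auto simp: integrable_on_def)
  then have "set_integrable lebesgue {0..1} ?g"
    by (intro nonnegative_absolutely_integrable_1) auto
  then have "integrable lborel (\<lambda>t. indicator {0..1} t *\<^sub>R ?g t)"
    unfolding set_integrable_def by (subst (asm) integrable_completion) auto
  from lborel_integrable_real_affine[OF this, of "1/2" "1/2"]
  have "integrable lborel (\<lambda>z. 2 powr (\<alpha> + \<beta>) * (indicator {0..1} (1/2 + 1/2 * z) *\<^sub>R ?g (1/2 + 1/2 * z)))"
    by simp
  moreover have "2 powr (\<alpha> + \<beta>) * (indicator {0..1} (1/2 + 1/2 * z) *\<^sub>R ?g (1/2 + 1/2 * z))
      = jacobi_weight \<alpha> \<beta> z" for z :: real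
  proof (cases "z \<in> {-1..1}")
    case True
    have half: "1/2 + 1/2 * z = (1 + z) / 2" "1 - (1 + z) / 2 = (1 - z) / 2"
      by (simp_all add: field_simps)
    have "((1 + z) / 2) powr \<beta> = (1 + z) powr \<beta> / 2 powr \<beta>"
      "((1 - z) / 2) powr \<alpha> = (1 - z) powr \<alpha> / 2 powr \<alpha>"
      using True by (simp_all add: powr_divide)
    then have "?g (1/2 + 1/2 * z) = (1 + z) powr \<beta> / 2 powr \<beta> * ((1 - z) powr \<alpha> / 2 powr \<alpha>)"
      by (simp only: half)
    moreover have "1/2 + 1/2 * z \<in> {0..1}" using True by auto
    ultimately show ?thesis
      using True by (simp add: jacobi_weight_def powr_add)
  qed (auto simp: jacobi_weight_def indicator_def)
  ultimately show ?thesis by (simp only:)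
qed

lemma integrable_continuous_mult_jacobi_weight:
  assumes "\<alpha> > -1" "\<beta> > -1" "continuous_on UNIV f"
  shows "integrable lborel (\<lambda>z. f z * jacobi_weight \<alpha> \<beta> z)"
proof -
  have "compact (f ` {-1..1})"
    using assms(3) by (intro compact_continuous_image continuous_on_subset[OF assms(3)]) auto
  then obtain K where K: "\<And>z. z \<in> {-1..1} \<Longrightarrow> \<bar>f z\<bar> \<le> K"
    using compact_imp_bounded by (fastforce simp: bounded_iff)
  have [measurable]: "f \<in> borel_measurable borel"
    using assms(3) by (rule borel_measurable_continuous_onI)
  show ?thesis
  proof (rule Bochner_Integration.integrable_bound)
    show "integrable lborel (\<lambda>z. K * jacobi_weight \<alpha> \<beta> z)"
      using integrable_jacobi_weight[OF assms(1,2)] by simp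
    have "\<bar>f z * jacobi_weight \<alpha> \<beta> z\<bar> \<le> \<bar>K * jacobi_weight \<alpha> \<beta> z\<bar>" for z
    proof (cases "z \<in> {-1..1}")
      case True
      then show ?thesis
        using K[OF True] by (auto simp: abs_mult intro!: mult_right_mono)
    qed (simp add: jacobi_weight_def)
    then show "AE z in lborel. norm (f z * jacobi_weight \<alpha> \<beta> z) \<le> norm (K * jacobi_weight \<alpha> \<beta> z)"
      by simp
  qed measurable
qed

lemma integrable_jacobi_moment:
  assumes "\<alpha> > -1" "\<beta> > -1"
  shows "integrable lborel (\<lambda>z. poly p z * exp (x * z) * jacobi_weight \<alpha> \<beta> z)"
  by (intro integrable_continuous_mult_jacobi_weight assms continuous_intros)

text \<open>If the integral vanished, so would the integrand almost everywhere; but \<open>p\<close>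
  has finitely many roots and the weight is positive inside the interval.\<close>

lemma jacobi_moment_square_pos:
  assumes "\<alpha> > -1" "\<beta> > -1" "p \<noteq> 0"
  shows "jacobi_moment \<alpha> \<beta> x (p * p) > 0"
proof -
  let ?f = "\<lambda>z. poly (p * p) z * exp (x * z) * jacobi_weight \<alpha> \<beta> z"
  have nonneg: "?f z \<ge> 0" for z by (simp add: jacobi_weight_nonneg)
  have "jacobi_moment \<alpha> \<beta> x (p * p) \<noteq> 0"
  proof
    assume "jacobi_moment \<alpha> \<beta> x (p * p) = 0"
    then have "AE z in lborel. ?f z = 0"
      using integral_nonneg_eq_0_iff_AE[OF integrable_jacobi_moment[OF assms(1,2)], of "p * p" x] nonneg
      by (simp add: jacobi_moment_def)
    moreover have "AE z in lborel. z \<notin> {z. poly p z = 0}"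
      using finite_imp_null_set_lborel[OF poly_roots_finite[OF assms(3)]] by (rule AE_not_in)
    ultimately have "AE z in lborel. z \<notin> {-1<..<1::real}"
      by eventually_elim (auto simp: jacobi_weight_def)
    then have "emeasure lborel {-1<..<1::real} = 0"
      by (subst (asm) AE_iff_measurable[of "{-1<..<1}"]) auto
    then show False by simp
  qed
  moreover have "jacobi_moment \<alpha> \<beta> x (p * p) \<ge> 0"
    unfolding jacobi_moment_def by (rule integral_nonneg_AE) (use nonneg in simp)
  ultimately show ?thesis by simp
qed

text \<open>Compactness of the support gives a Taylor remainder of order \<open>h\<^sup>2\<close>
  uniformly in \<open>z\<close>, so the difference quotient is off by at most a constant times
  \<open>\<bar>h\<bar>\<close>.\<close>

lemma DERIV_jacobi_moment:
  assumes "\<alpha> > -1" "\<beta> > -1"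
  shows "((\<lambda>y. jacobi_moment \<alpha> \<beta> y p) has_real_derivative jacobi_moment \<alpha> \<beta> x (pCons 0 p)) (at x)"
proof -
  define K where "K = (\<integral>z. \<bar>poly p z\<bar> * exp (x * z) * jacobi_weight \<alpha> \<beta> z \<partial>lborel)"
  note integrable = integrable_jacobi_moment[OF assms]
  have bound: "\<bar>(jacobi_moment \<alpha> \<beta> (x + h) p - jacobi_moment \<alpha> \<beta> x p) / h - jacobi_moment \<alpha> \<beta> x (pCons 0 p)\<bar>
      \<le> \<bar>h\<bar> * (exp 1 * K)" if h: "h \<noteq> 0" "\<bar>h\<bar> < 1" for h
  proof -
    let ?d = "\<lambda>z. poly p z * exp ((x + h) * z) * jacobi_weight \<alpha> \<beta> z - poly p z * exp (x * z) * jacobi_weight \<alpha> \<beta> z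
        - h * (poly (pCons 0 p) z * exp (x * z) * jacobi_weight \<alpha> \<beta> z)"
    have d_bound: "\<bar>?d z\<bar> \<le> h\<^sup>2 * exp 1 * (\<bar>poly p z\<bar> * exp (x * z) * jacobi_weight \<alpha> \<beta> z)" for z
    proof (cases "z \<in> {-1..1}")
      case True
      then have hz: "\<bar>h * z\<bar> \<le> \<bar>h\<bar>" by (auto simp: abs_mult mult_left_le)
      have "\<bar>exp (h * z) - 1 - h * z\<bar> \<le> exp \<bar>h * z\<bar> * \<bar>h * z\<bar>\<^sup>2"
        using Taylor_exp_field[of "h * z" 1] by (simp add: numeral_2_eq_2 algebra_simps)
      also have "\<dots> \<le> exp 1 * \<bar>h\<bar>\<^sup>2"
        using hz h by (intro mult_mono power_mono) auto
      finally have e: "\<bar>exp (h * z) - 1 - h * z\<bar> \<le> h\<^sup>2 * exp 1" by (simp add: mult.commute)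
      have "?d z = (exp (h * z) - 1 - h * z) * (poly p z * exp (x * z) * jacobi_weight \<alpha> \<beta> z)"
        by (simp add: algebra_simps exp_add)
      then have "\<bar>?d z\<bar> = \<bar>exp (h * z) - 1 - h * z\<bar> * (\<bar>poly p z\<bar> * exp (x * z) * jacobi_weight \<alpha> \<beta> z)"
        by (simp add: abs_mult jacobi_weight_nonneg)
      also have "\<dots> \<le> h\<^sup>2 * exp 1 * (\<bar>poly p z\<bar> * exp (x * z) * jacobi_weight \<alpha> \<beta> z)"
        using e by (rule mult_right_mono) (simp add: jacobi_weight_nonneg)
      finally show ?thesis .
    qed (simp add: jacobi_weight_def)
    have int_d: "integrable lborel ?d"
      by (intro Bochner_Integration.integrable_diff integrable_mult_right integrable)
    have int_K: "integrable lborel (\<lambda>z. \<bar>poly p z\<bar> * exp (x * z) * jacobi_weight \<alpha> \<beta> z)"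
      by (intro integrable_continuous_mult_jacobi_weight assms continuous_intros)
    have "integral\<^sup>L lborel ?d = jacobi_moment \<alpha> \<beta> (x + h) p - jacobi_moment \<alpha> \<beta> x p - h * jacobi_moment \<alpha> \<beta> x (pCons 0 p)"
      unfolding jacobi_moment_def
      by (subst Bochner_Integration.integral_diff, intro Bochner_Integration.integrable_diff integrable,
          intro integrable_mult_right integrable,
          subst Bochner_Integration.integral_diff, intro integrable, intro integrable,
          subst integral_mult_right_zero, rule refl)
    moreover have "\<bar>integral\<^sup>L lborel ?d\<bar> \<le> (\<integral>z. h\<^sup>2 * exp 1 * (\<bar>poly p z\<bar> * exp (x * z) * jacobi_weight \<alpha> \<beta> z) \<partial>lborel)"
      using Bochner_Integration.integral_norm_bound_integral[OF int_d integrable_mult_right[OF int_K, of "h\<^sup>2 * exp 1"]] d_bound by simp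
    ultimately have "\<bar>jacobi_moment \<alpha> \<beta> (x + h) p - jacobi_moment \<alpha> \<beta> x p - h * jacobi_moment \<alpha> \<beta> x (pCons 0 p)\<bar>
        \<le> h\<^sup>2 * exp 1 * K"
      by (simp only: integral_mult_right_zero K_def)
    then have "\<bar>jacobi_moment \<alpha> \<beta> (x + h) p - jacobi_moment \<alpha> \<beta> x p - h * jacobi_moment \<alpha> \<beta> x (pCons 0 p)\<bar> / \<bar>h\<bar>
        \<le> h\<^sup>2 * exp 1 * K / \<bar>h\<bar>"
      by (rule divide_right_mono) simp
    also have "h\<^sup>2 * exp 1 * K / \<bar>h\<bar> = \<bar>h\<bar> * (exp 1 * K)"
      using h by (simp add: field_simps power2_eq_square abs_if)
    finally show ?thesis
      using h(1) by (simp add: abs_divide[symmetric] diff_divide_distrib)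
  qed
  have "((\<lambda>h. (jacobi_moment \<alpha> \<beta> (x + h) p - jacobi_moment \<alpha> \<beta> x p) / h - jacobi_moment \<alpha> \<beta> x (pCons 0 p)) \<longlongrightarrow> 0) (at 0)"
  proof (rule Lim_null_comparison)
    have "eventually (\<lambda>h::real. \<bar>h\<bar> < 1) (at 0)"
      by (auto simp: eventually_at intro!: exI[of _ 1])
    then show "\<forall>\<^sub>F h in at 0. norm ((jacobi_moment \<alpha> \<beta> (x + h) p - jacobi_moment \<alpha> \<beta> x p) / h
        - jacobi_moment \<alpha> \<beta> x (pCons 0 p)) \<le> \<bar>h\<bar> * (exp 1 * K)"
      using eventually_neq_at_within[of 0 0 UNIV] by eventually_elim (use bound in simp)
    show "((\<lambda>h. \<bar>h\<bar> * (exp 1 * K)) \<longlongrightarrow> 0) (at 0)"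
      by (auto intro!: tendsto_eq_intros)
  qed
  then show ?thesis unfolding DERIV_def by (rule LIM_zero_cancel)
qed

lemma moment_functional_jacobi:
  assumes "\<alpha> > -1" "\<beta> > -1"
  shows "moment_functional (jacobi_moment \<alpha> \<beta>)"
proof
  fix x c :: real and p q :: "real poly"
  note integrable = integrable_jacobi_moment[OF assms]
  show "jacobi_moment \<alpha> \<beta> x (p + q) = jacobi_moment \<alpha> \<beta> x p + jacobi_moment \<alpha> \<beta> x q"
    unfolding jacobi_moment_def
    by (subst Bochner_Integration.integral_add[OF integrable integrable, symmetric]) (simp add: algebra_simps)
  show "jacobi_moment \<alpha> \<beta> x (smult c p) = c * jacobi_moment \<alpha> \<beta> x p"
    unfolding jacobi_moment_def by (simp add: mult.assoc)
qed (use jacobi_moment_square_pos DERIV_jacobi_moment assms in auto)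

text \<open>The integrand is the derivative of \<open>(1 - z)\<^sup>\<alpha>\<^sup>+\<^sup>1 (1 + z)\<^sup>\<beta>\<^sup>+\<^sup>1 e\<^sup>x\<^sup>z\<close>.\<close>

lemma jacobi_pearson:
  assumes "\<alpha> > -1" "\<beta> > -1"
  shows "jacobi_moment \<alpha> \<beta> x [: x - (\<alpha> - \<beta>), - (\<alpha> + \<beta> + 2), - x :] = 0"
proof -
  let ?F = "\<lambda>z. (1 - z) powr (\<alpha> + 1) * (1 + z) powr (\<beta> + 1) * exp (x * z)"
  let ?f = "\<lambda>z. poly [: x - (\<alpha> - \<beta>), - (\<alpha> + \<beta> + 2), - x :] z * exp (x * z) * jacobi_weight \<alpha> \<beta> z"
  have "(?f has_integral ?F 1 - ?F (-1)) {-1..1}"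
  \<comment> \<open>Differentiability may fail at the endpoints, but the exponents \<alpha> + 1 and
    \<beta> + 1 are positive, so \<open>?F\<close> is continuous there and vanishes.\<close>
  proof (rule fundamental_theorem_of_calculus_interior)
    show "continuous_on {-1..1} ?F"
      using assms by (intro continuous_intros continuous_on_powr') auto
    fix z :: real assume z: "z \<in> {-1<..<1}"
    have p: "(1 - z) powr (\<alpha> + 1) = (1 - z) * (1 - z) powr \<alpha>" "(1 + z) powr (\<beta> + 1) = (1 + z) * (1 + z) powr \<beta>"
      using z by (simp_all add: powr_add)
    have "(?F has_real_derivative
        - (\<alpha> + 1) * (1 - z) powr \<alpha> * (1 + z) powr (\<beta> + 1) * exp (x * z)
        + (1 - z) powr (\<alpha> + 1) * ((\<beta> + 1) * (1 + z) powr \<beta>) * exp (x * z)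
        + (1 - z) powr (\<alpha> + 1) * (1 + z) powr (\<beta> + 1) * (x * exp (x * z))) (at z)"
      using z by (auto intro!: derivative_eq_intros simp: algebra_simps)
    moreover have "- (\<alpha> + 1) * (1 - z) powr \<alpha> * (1 + z) powr (\<beta> + 1) * exp (x * z)
        + (1 - z) powr (\<alpha> + 1) * ((\<beta> + 1) * (1 + z) powr \<beta>) * exp (x * z)
        + (1 - z) powr (\<alpha> + 1) * (1 + z) powr (\<beta> + 1) * (x * exp (x * z)) = ?f z"
      using z unfolding p by (simp add: jacobi_weight_def algebra_simps)
    ultimately show "(?F has_vector_derivative ?f z) (at z)"
      by (simp add: has_real_derivative_iff_has_vector_derivative)
  qed simp
  moreover have "?F 1 = 0" "?F (-1) = 0" using assms by auto
  ultimately have "(?f has_integral 0) {-1..1}" by simp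
  then have "(?f has_integral 0) UNIV"
    by (rule has_integral_on_superset) (auto simp: jacobi_weight_def)
  moreover have "(?f has_integral jacobi_moment \<alpha> \<beta> x [: x - (\<alpha> - \<beta>), - (\<alpha> + \<beta> + 2), - x :]) UNIV"
    unfolding jacobi_moment_def by (rule has_integral_integral_lborel[OF integrable_jacobi_moment[OF assms]])
  ultimately show ?thesis by (rule has_integral_unique[symmetric])
qed

section \<open>The matrix integral\<close>

text \<open>Both Vandermonde factors become sums over permutations and the integral factorises.
  Orthogonality leaves only equal pairs, each contributing the same product, and there are
  \<open>fact n\<close> of them.\<close>

lemma tau_eq_prod_norms:
  assumes "\<alpha> > -1" "\<beta> > -1"
  shows "tau n \<alpha> \<beta> c x = c * fact n * (\<Prod>k<n. moment_functional.h (jacobi_moment \<alpha> \<beta>) x k)"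
proof -
  interpret M: moment_functional "jacobi_moment \<alpha> \<beta>"
    by (rule moment_functional_jacobi[OF assms])
  interpret product_sigma_finite "\<lambda>_::nat. lborel :: real measure" by standard
  let ?S = "{p. p permutes {..<n}}"
  let ?f = "\<lambda>p q z. \<Prod>k<n. poly (M.P x (p k) * M.P x (q k)) (z k) * exp (x * z k) * jacobi_weight \<alpha> \<beta> (z k)"
  let ?sg = "\<lambda>p q. real_of_int (sign p) * real_of_int (sign q)"
  have fin: "finite ?S" by (rule finite_permutations) simp
  have integrable: "integrable (PiM {..<n} (\<lambda>_. lborel)) (?f p q)" for p q
    by (intro product_integrable_prod integrable_jacobi_moment assms) simp
  have integral: "integral\<^sup>L (PiM {..<n} (\<lambda>_. lborel)) (?f p q) = (if q = p then \<Prod>k<n. M.h x k else 0)"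
    if p: "p \<in> ?S" and q: "q \<in> ?S" for p q
  proof -
    have "integral\<^sup>L (PiM {..<n} (\<lambda>_. lborel)) (?f p q) = (\<Prod>k<n. jacobi_moment \<alpha> \<beta> x (M.P x (p k) * M.P x (q k)))"
      unfolding jacobi_moment_def by (intro product_integral_prod integrable_jacobi_moment assms) simp
    also have "\<dots> = (\<Prod>k<n. if p k = q k then M.h x (p k) else 0)"
      by (simp add: M.L_P_mult_P)
    also have "\<dots> = (if q = p then \<Prod>k<n. M.h x k else 0)"
    proof (cases "q = p")
      case True
      have "(\<Prod>k<n. M.h x (p k)) = (\<Prod>k<n. M.h x k)"
        using prod.permute[of p "{..<n}" "M.h x"] p by (simp add: o_def)
      then show ?thesis using True by simp
    next
      case False
      \<comment> \<open>Both permutations fix every index outside \<open>{..<n}\<close>, so they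
        differ below \<open>n\<close>, where orthogonality yields a zero factor.\<close>
      then obtain k where k: "p k \<noteq> q k" by (metis ext)
      have "k < n"
      proof (rule ccontr)
        assume "\<not> k < n"
        then show False using k p q by (auto simp: permutes_def)
      qed
      then have "(\<Prod>k<n. if p k = q k then M.h x (p k) else 0) = 0"
        using k by (intro prod_zero) auto
      then show ?thesis using False by simp
    qed
    finally show ?thesis .
  qed
  have integrand: "indicator (PiE {..<n} (\<lambda>_. {-1..1})) z *\<^sub>R
      ((vandermonde n z)\<^sup>2 * (\<Prod>k<n. exp (x * z k) * (1 - z k) powr \<alpha> * (1 + z k) powr \<beta>))
      = (\<Sum>p\<in>?S. \<Sum>q\<in>?S. ?sg p q * ?f p q z)"
    if "z \<in> space (PiM {..<n} (\<lambda>_. lborel :: real measure))" for z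
  proof -
    \<comment> \<open>Points of the product space are extensional, so membership in the cube depends
      only on the coordinates below \<open>n\<close>.\<close>
    have ext: "z \<in> extensional {..<n}" using that by (simp add: space_PiM PiE_def)
    have ind: "indicator (PiE {..<n} (\<lambda>_. {-1..1})) z = (\<Prod>k<n. indicator {-1..1} (z k) :: real)"
    proof (cases "z \<in> PiE {..<n} (\<lambda>_. {-1..1})")
      case True
      then have "z k \<in> {-1..1}" if "k < n" for k
        using that PiE_mem[OF True, of k] by simp
      then have "(\<Prod>k<n. indicator {-1..1} (z k) :: real) = 1"
        by (intro prod.neutral) (auto simp: indicator_def)
      then show ?thesis using True by simp
    next
      case False
      have "\<not> (\<forall>k<n. z k \<in> {-1..1})"
      proof
        assume "\<forall>k<n. z k \<in> {-1..1}"
        then have "z \<in> PiE {..<n} (\<lambda>_. {-1..1})" using ext by (simp add: PiE_def Pi_def)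
        with False show False ..
      qed
      then obtain k where "k < n" "z k \<notin> {-1..1}" by blast
      then have "(\<Prod>k<n. indicator {-1..1} (z k) :: real) = 0"
        by (intro prod_zero) (auto simp: indicator_def)
      then show ?thesis using False by simp
    qed
    have w: "(\<Prod>k<n. indicator {-1..1} (z k)) * (\<Prod>k<n. exp (x * z k) * (1 - z k) powr \<alpha> * (1 + z k) powr \<beta>)
        = (\<Prod>k<n. exp (x * z k) * jacobi_weight \<alpha> \<beta> (z k))"
      unfolding prod.distrib[symmetric] by (intro prod.cong) (auto simp: jacobi_weight_def)
    have "indicator (PiE {..<n} (\<lambda>_. {-1..1})) z *\<^sub>R
      ((vandermonde n z)\<^sup>2 * (\<Prod>k<n. exp (x * z k) * (1 - z k) powr \<alpha> * (1 + z k) powr \<beta>))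
      = (vandermonde n z)\<^sup>2 * (\<Prod>k<n. exp (x * z k) * jacobi_weight \<alpha> \<beta> (z k))"
      unfolding ind w[symmetric] by simp
    also have "\<dots> = (\<Sum>p\<in>?S. \<Sum>q\<in>?S. (real_of_int (sign p) * (\<Prod>i<n. poly (M.P x (p i)) (z i)))
        * (real_of_int (sign q) * (\<Prod>i<n. poly (M.P x (q i)) (z i))))
        * (\<Prod>k<n. exp (x * z k) * jacobi_weight \<alpha> \<beta> (z k))"
      unfolding vandermonde_eq_alternant[of "M.P x", OF M.degree_P_le M.coeff_P] power2_eq_square sum_product ..
    also have "\<dots> = (\<Sum>p\<in>?S. \<Sum>q\<in>?S. ?sg p q * ?f p q z)"
      unfolding sum_distrib_right by (intro sum.cong refl) (simp add: prod.distrib mult_ac)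
    finally show ?thesis .
  qed
  have "(LINT z : PiE {..<n} (\<lambda>_. {-1..1}) | PiM {..<n} (\<lambda>_. lborel).
      (vandermonde n z)\<^sup>2 * (\<Prod>k<n. exp (x * z k) * (1 - z k) powr \<alpha> * (1 + z k) powr \<beta>))
      = (\<integral>z. (\<Sum>p\<in>?S. \<Sum>q\<in>?S. ?sg p q * ?f p q z) \<partial>PiM {..<n} (\<lambda>_. lborel))"
    unfolding set_lebesgue_integral_def by (rule Bochner_Integration.integral_cong[OF refl integrand])
  also have "\<dots> = (\<Sum>p\<in>?S. \<Sum>q\<in>?S. ?sg p q * integral\<^sup>L (PiM {..<n} (\<lambda>_. lborel)) (?f p q))"
    by (simp only: Bochner_Integration.integral_sum Bochner_Integration.integrable_sum
        integrable_mult_right integrable integral_mult_right_zero)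
  also have "\<dots> = (\<Sum>p\<in>?S. \<Sum>q\<in>?S. if q = p then \<Prod>k<n. M.h x k else 0)"
    by (intro sum.cong refl, simp only: integral) (simp add: sign_def)
  also have "\<dots> = (\<Sum>p\<in>?S. \<Prod>k<n. M.h x k)"
    using fin by (intro sum.cong refl) (simp add: sum.delta)
  also have "\<dots> = fact n * (\<Prod>k<n. M.h x k)"
    by (simp add: card_permutations[of "{..<n}" n])
  finally show ?thesis by (simp add: tau_def)
qed

section \<open>The Jacobi weight as a Toda chain, and the differential equation\<close>

lemma jacobi_toda_moments:
  fixes \<alpha> \<beta> :: real
  assumes "\<alpha> > -1" "\<beta> > -1"
  defines "h \<equiv> moment_functional.h (jacobi_moment \<alpha> \<beta>)"
  shows "jacobi_toda (\<lambda>n x. case n of 0 \<Rightarrow> 0 | Suc k \<Rightarrow> h x (Suc k) / h x k)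
    (\<lambda>n x. moment_functional.b (jacobi_moment \<alpha> \<beta>) x n)
    (\<lambda>n x. moment_functional.S (jacobi_moment \<alpha> \<beta>) x n) (\<alpha> + \<beta>) (\<alpha> - \<beta>)"
proof -
  interpret M: moment_functional "jacobi_moment \<alpha> \<beta>"
    by (rule moment_functional_jacobi[OF assms(1,2)])
  let ?L = "jacobi_moment \<alpha> \<beta>"
  show ?thesis
  proof
    fix x :: real and n :: nat
    show "M.S x 0 = 0" by (rule M.S_0)
    show "M.S x (Suc n) = M.S x n + M.b x n" by (rule M.S_Suc)
    show "((\<lambda>x. M.S x n) has_real_derivative (case n of 0 \<Rightarrow> 0 | Suc k \<Rightarrow> h x (Suc k) / h x k)) (at x)"
    proof (cases n)
      case 0
      then show ?thesis by (simp add: M.S_0)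
    next
      case (Suc k)
      then show ?thesis using M.DERIV_S_Suc[of k x] by (simp add: h_def)
    qed
    show "(case Suc n of 0 \<Rightarrow> 0 | Suc k \<Rightarrow> h x (Suc k) / h x k) \<noteq> 0"
      using M.h_pos[of x n] M.h_pos[of x "Suc n"] by (simp add: h_def)
    have "((\<lambda>x. M.h x (Suc n) / M.h x n) has_real_derivative
       (M.b x (Suc n) * M.h x (Suc n) * M.h x n - M.h x (Suc n) * (M.b x n * M.h x n)) / (M.h x n * M.h x n)) (at x)"
      using M.h_pos[of x n] by (intro DERIV_divide M.DERIV_h) simp
    moreover have "(M.b x (Suc n) * M.h x (Suc n) * M.h x n - M.h x (Suc n) * (M.b x n * M.h x n)) / (M.h x n * M.h x n)
        = M.h x (Suc n) / M.h x n * (M.b x (Suc n) - M.b x n)"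
      using M.h_pos[of x n] by (simp add: field_simps)
    ultimately show "((\<lambda>x. case Suc n of 0 \<Rightarrow> 0 | Suc k \<Rightarrow> h x (Suc k) / h x k) has_real_derivative
        (case Suc n of 0 \<Rightarrow> 0 | Suc k \<Rightarrow> h x (Suc k) / h x k) * (M.b x (Suc n) - M.b x n)) (at x)"
      by (simp add: h_def)
    \<comment> \<open>For the Riccati equation, \<open>b\<^sub>0\<close> is the first moment over
      the zeroth. Two computations of its derivative show that \<open>a\<^sub>1\<close> is the
      variance of the normalised weight, and the Pearson relation divided by the zeroth moment does
      the rest.\<close>
    have L1: "?L x 1 > 0" using M.h_pos[of x 0] by (simp add: M.h_def M.P_0)
    have b0: "M.b y 0 = ?L y [:0, 1:] / ?L y 1" for y
      by (simp add: M.b_def M.h_def M.P_0 one_pCons)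
    have "((\<lambda>y. ?L y [:0, 1:] / ?L y 1) has_real_derivative
        (?L x [:0, 0, 1:] * ?L x 1 - ?L x [:0, 1:] * ?L x [:0, 1:]) / (?L x 1 * ?L x 1)) (at x)"
      using L1 M.DERIV_L[of "[:0, 1:]" x] M.DERIV_L[of 1 x] by (intro DERIV_divide) (simp_all add: one_pCons)
    moreover have "(\<lambda>y. M.S y (Suc 0)) = (\<lambda>y. ?L y [:0, 1:] / ?L y 1)"
      by (simp add: M.S_Suc M.S_0 b0 fun_eq_iff)
    then have "((\<lambda>y. ?L y [:0, 1:] / ?L y 1) has_real_derivative M.h x (Suc 0) / M.h x 0) (at x)"
      using M.DERIV_S_Suc[of 0 x] by (simp only:)
    ultimately have a1: "M.h x (Suc 0) / M.h x 0 =
        (?L x [:0, 0, 1:] * ?L x 1 - ?L x [:0, 1:] * ?L x [:0, 1:]) / (?L x 1 * ?L x 1)"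
      by (rule DERIV_unique[rotated])
    have "[: x - (\<alpha> - \<beta>), - (\<alpha> + \<beta> + 2), - x :] =
        smult (x - (\<alpha> - \<beta>)) 1 - smult (\<alpha> + \<beta> + 2) [:0, 1:] - smult x [:0, 0, 1:]"
      by (simp add: one_pCons)
    then have "(x - (\<alpha> - \<beta>)) * ?L x 1 - (\<alpha> + \<beta> + 2) * ?L x [:0, 1:] - x * ?L x [:0, 0, 1:] = 0"
      using jacobi_pearson[OF assms(1,2), of x] by (simp only: M.L_diff M.L_smult)
    then have "(2 + (\<alpha> + \<beta>)) * (?L x [:0, 1:] / ?L x 1) + (\<alpha> - \<beta>) = x * (1 - ?L x [:0, 0, 1:] / ?L x 1)"
      using L1 by (simp add: field_simps)
    moreover have "M.h x (Suc 0) / M.h x 0 + (?L x [:0, 1:] / ?L x 1)\<^sup>2 = ?L x [:0, 0, 1:] / ?L x 1"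
      unfolding a1 using L1 by (simp add: field_simps power2_eq_square)
    ultimately show "(2 + (\<alpha> + \<beta>)) * M.b x 0 + (\<alpha> - \<beta>) =
        x * (1 - (case 1 of 0 \<Rightarrow> 0 | Suc k \<Rightarrow> h x (Suc k) / h x k) - (M.b x 0)\<^sup>2)"
      by (simp add: b0 h_def algebra_simps)
  qed
qed

theorem theorem3p1:
  fixes n :: nat and \<alpha> \<beta> c :: real and H :: "real \<Rightarrow> real"
  assumes "n \<ge> 1" and "\<alpha> > -1" and "\<beta> > -1" and "c \<noteq> 0"
    and "H = (\<lambda>x. x * deriv (tau n \<alpha> \<beta> c) x / tau n \<alpha> \<beta> c x)"
  shows "(\<forall>x. H differentiable at x \<and> deriv H differentiable at x
              \<and> (deriv ^^ 2) H differentiable at x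
              \<and> x^2 * (deriv ^^ 3) H x + x * (deriv ^^ 2) H x + 6 * x * (deriv H x)^2
                - (4 * H x + 4 * x^2 - 4 * (\<alpha> - \<beta>) * x + (2 * real n + (\<alpha> + \<beta>))^2) * deriv H x
                + (4 * x - 2 * (\<alpha> - \<beta>)) * H x + 2 * real n * (real n + (\<alpha> + \<beta>)) * x
                - (\<alpha> - \<beta>) * real n * (2 * real n + (\<alpha> + \<beta>)) = 0)
         \<and> H 0 = 0
         \<and> deriv H 0 = - real n * (\<alpha> - \<beta>) / ((\<alpha> + \<beta>) + 2 * real n)"
proof -
  interpret M: moment_functional "jacobi_moment \<alpha> \<beta>"
    by (rule moment_functional_jacobi[OF assms(2,3)])
  interpret T: jacobi_toda "\<lambda>n x. case n of 0 \<Rightarrow> 0 | Suc k \<Rightarrow> M.h x (Suc k) / M.h x k"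
      "\<lambda>n x. M.b x n" "\<lambda>n x. M.S x n" "\<alpha> + \<beta>" "\<alpha> - \<beta>"
    by (rule jacobi_toda_moments[OF assms(2,3)])
  have tau: "tau n \<alpha> \<beta> c = (\<lambda>x. c * fact n * (\<Prod>k<n. M.h x k))"
    using tau_eq_prod_norms[OF assms(2,3)] by auto
  have nz: "(\<Prod>k<n. M.h x k) \<noteq> 0" for x
    using M.h_pos by (auto simp: less_imp_neq[symmetric])
  have "(tau n \<alpha> \<beta> c has_real_derivative tau n \<alpha> \<beta> c x * M.S x n) (at x)" for x
    unfolding tau using DERIV_cmult[OF M.DERIV_prod_h[of n x], of "c * fact n"] by (simp add: mult.assoc)
  then have "deriv (tau n \<alpha> \<beta> c) x = tau n \<alpha> \<beta> c x * M.S x n" for x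
    by (rule DERIV_imp_deriv)
  moreover have "tau n \<alpha> \<beta> c x \<noteq> 0" for x
    using nz[of x] assms(4) by (simp add: tau)
  ultimately have H: "H = (\<lambda>x. x * M.S x n)"
    by (simp add: assms(5))
  \<comment> \<open>At \<open>x = 0\<close> the flow equation determines \<open>M.S 0 n\<close>, the
    value of \<open>deriv H 0\<close>; its coefficient is positive because \<open>n \<ge> 1\<close>
    and \<alpha> + \<beta> exceeds -2.\<close>
  have "2 * real n + (\<alpha> + \<beta>) > 0" using assms(1-3) by linarith
  moreover have "(2 * real n + (\<alpha> + \<beta>)) * M.S 0 n + real n * (\<alpha> - \<beta>) = 0"
    using T.flow_eq[of 0 n] by simp
  ultimately have "M.S 0 n = - real n * (\<alpha> - \<beta>) / ((\<alpha> + \<beta>) + 2 * real n)"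
    by (simp add: field_simps)
  then have "deriv H 0 = - real n * (\<alpha> - \<beta>) / ((\<alpha> + \<beta>) + 2 * real n)"
    using T.sigma_form(5)[OF assms(1)] unfolding H by simp
  moreover have "H 0 = 0" by (simp add: H)
  ultimately show ?thesis
    using T.sigma_form(1-4)[OF assms(1)] unfolding H by blast
qed

end
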